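(* Let $d,M,N\ge 1$ be integers, let $\sigma:\mathbb{R}\to\mathbb{R}$ be twice differentiable, and let $\mathcal{J}^{\mathrm p}$ (the PINN loss) and $\mathcal{J}^{\mathrm p}_{\mathrm S}$ (the layer separation loss) for the parabolic problem be as defined in the context. Then for all network parameters $W_1\in\mathbb{R}^{M\times(d+1)}$, $W_2\in\mathbb{R}^{M\times M}$, $W_3\in\mathbb{R}^{1\times M}$, $b_1,b_2\in\mathbb{R}^{M}$, $b_3\in\mathbb{R}$ there exist auxiliary variables $a_1,a_2\in\mathbb{R}^{M\times N}$, $d_{1i},d_{2i}\in\mathbb{R}^{M\times N}$ ($i=0,\dots,d$) and $q_i\in\mathbb{R}^{M\times N}$ ($i=1,\dots,d$) such that $$\mathcal{J}^{\mathrm p}_{\mathrm S}\le \mathcal{J}^{\mathrm p}.$$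
   Context: Conventions: $*$ is the entrywise (Hadamard) product; $\sigma,\sigma',\sigma''$ act entrywise on matrices; $\mathbf 1$ is the all-one column vector of length $N$; $\|\cdot\|_{\mathrm F}$ is the Frobenius norm (Euclidean norm for vectors); $|v|_\infty$ is the maximum absolute value of the entries of a vector $v$; $A(:,i)$ is the $i$-th column of $A$ and $A[n]$ the $n$-th column of an $M\times N$ matrix $A$; for a diagonal $N\times N$ matrix $\mathcal D$ with nonnegative diagonal entries, $\|A\|_{\mathcal D}=\big(\sum_{n=1}^N \mathcal D(n,n)^2\|A[n]\|_2^2\big)^{1/2}$; $I$ is the identity matrix. Data: $T>0$; $\Omega=\{x\in\mathbb{R}^d:\|x\|_2\le1\}$; $c$ is a real function, continuously differentiable on a neighbourhood of $\Omega$, with $c(x)>\delta$ on $\Omega$ for some $\delta>0$; $Q:[0,T]\times\Omega\to\mathbb{R}$; $(t_1,x_1),\dots,(t_N,x_N)\in[0,T]\times\Omega$; $y_n=Q(t_n,x_n)$; $X=[x_1\cdots x_N]\in\mathbb{R}^{d\times N}$, with $i$-th row $X(i,:)$; $Y=[y_1\cdots y_N]$; $\hat X=[\|x_1\|_2^2\cdots\|x_N\|_2^2]$, and $\hat X-1$ subtracts $1$ from each entry; $T_0=[t_1\cdots t_N]\in\mathbb{R}^{1\times N}$; $X_T\in\mathbb{R}^{(d+1)\times N}$ is $T_0$ stacked on top of $X$. $c(X)$ and $\partial_{x_i}c(X)$ are the row vectors of values $c(x_n)$ and $(\partial_{x_i}c)(x_n)$. The first column $W_1(:,1)$ corresponds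 to the time variable and $W_1(:,i+1)$ to $x_i$. PINN loss: with $\phi(t,x)=W_3\sigma(W_2\sigma(W_1[t;x]+b_1)+b_2)+b_3$, where $[t;x]\in\mathbb{R}^{d+1}$ is the column vector with entries $t,x_1,\dots,x_d$, and $\psi_{\mathrm p}(t,x)=t(\|x\|_2^2-1)\phi(t,x)$, $$\mathcal{J}^{\mathrm p}=\frac1N\sum_{n=1}^N\Big|\big[\partial_t\psi_{\mathrm p}-\nabla_x\cdot(c\nabla_x\psi_{\mathrm p})\big](t_n,x_n)-y_n\Big|^2 .$$ Coefficient row vectors: $K^{\mathrm p}=(\hat X-1)-2d\,c(X)*T_0-2T_0*\sum_{i=1}^d\partial_{x_i}c(X)*X(i,:)$; $K_0^{\mathrm p}=T_0*(\hat X-1)$; $K_i^{\mathrm p}=T_0*\big((\hat X-1)*\partial_{x_i}c(X)+4X(i,:)*c(X)\big)$ for $i=1,\dots,d$; $\hat K^{\mathrm p}=c(X)*T_0*(\hat X-1)$. Layer separation loss: $$\mathcal{J}^{\mathrm p}_{\mathrm S}=\frac1N\Big[\Big\|K^{\mathrm p}*(W_3\sigma(a_2)+b_3\mathbf 1^\top)+K_0^{\mathrm p}*(W_3(\sigma'(a_2)*d_{20}))-\sum_{i=1}^dK_i^{\mathrm p}*(W_3(\sigma'(a_2)*d_{2i}))-\hat K^{\mathrm p}*\sum_{i=1}^dW_3(\sigma''(a_2)*d_{2i}*d_{2i}+\sigma'(a_2)*q_i)-Y\Big\|_{\mathrm F}^2$$ $$+\omega_{a_1}^1\|W_1X_T+b_1\mathbf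 1^\top-a_1\|^2_{\mathcal D_{a_1}^1}+\sum_{k=2}^3\sum_{i=1}^d\omega_{a_1}^{ki}\|W_1X_T+b_1\mathbf 1^\top-a_1\|^2_{\mathcal D_{a_1}^{ki}}$$ $$+\omega_{a_2}^1\|W_2\sigma(a_1)+b_2\mathbf 1^\top-a_2\|^2_{\mathcal D_{a_2}^1}+\sum_{i=1}^d\omega_{a_2}^{2i}\|W_2\sigma(a_1)+b_2\mathbf 1^\top-a_2\|^2_{\mathcal D_{a_2}^{2i}}$$ $$+\omega_{d_{10}}\|W_1(:,1)\mathbf 1^\top-d_{10}\|_{\mathrm F}^2+\omega_{d_{20}}\|W_2(\sigma'(a_1)*d_{10})-d_{20}\|_{\mathrm F}^2$$ $$+\sum_{k=1}^2\sum_{i=1}^d\Big(\omega_{d_{1i}}^k\|W_1(:,i+1)\mathbf 1^\top-d_{1i}\|^2_{\mathcal D_{d_{1i}}^k}+\omega_{d_{2i}}^k\|W_2(\sigma'(a_1)*d_{1i})-d_{2i}\|^2_{\mathcal D_{d_{2i}}^k}\Big)+\sum_{i=1}^d\omega_{q_i}\|W_2(\sigma''(a_1)*d_{1i}*d_{1i})-q_i\|_{\mathrm F}^2\Big],$$ with weights ($i=1,\dots,d$): $\omega_{a_1}^1=\omega_{d_{1i}}^2=\|W_3\|_{\mathrm F}^2\|W_2\|_{\mathrm F}^2$; $\omega_{a_1}^{2i}=\omega_{a_2}^{2i}=\omega_{a_1}^1\|W_1(:,i+1)\|_{\mathrm F}^2$; $\omega_{a_1}^{3i}=\omega_{a_1}^{2i}\|W_2\|_{\mathrm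 F}^2$; $\omega_{a_2}^1=\omega_{d_{2i}}^1=\|W_3\|_{\mathrm F}^2$; $\omega_{d_{10}}=|K_0^{\mathrm p}|_\infty^2\omega_{a_1}^1$; $\omega_{d_{20}}=|K_0^{\mathrm p}|_\infty^2\omega_{a_2}^1$; $\omega_{d_{1i}}^1=|\hat K^{\mathrm p}|_\infty^2(\omega_{a_1}^{2i}+\omega_{a_1}^{3i})$; $\omega_{d_{2i}}^2=|\hat K^{\mathrm p}|_\infty^2\omega_{a_1}^{2i}$; $\omega_{q_i}=|\hat K^{\mathrm p}|_\infty^2\omega_{a_2}^1$; and diagonal $N\times N$ matrices with diagonal entries ($i=1,\dots,d$, $n=1,\dots,N$): $\mathcal D_{a_2}^1(n,n)=\big(|K^{\mathrm p}|_\infty^2+\sum_{i=0}^d|K_i^{\mathrm p}|_\infty^2\|d_{2i}[n]\|_{\mathrm F}^2+|\hat K^{\mathrm p}|_\infty^2\sum_{i=1}^d\|q_i[n]\|_{\mathrm F}^2\big)^{1/2}$; $\mathcal D_{a_1}^{2i}(n,n)=|\hat K^{\mathrm p}|_\infty\|d_{1i}[n]\|_{\mathrm F}$; $\mathcal D_{a_2}^{2i}(n,n)=|\hat K^{\mathrm p}|_\infty\|d_{2i}[n]\|_{\mathrm F}$; $\mathcal D_{a_1}^{3i}(n,n)=\big(\mathcal D_{a_1}^{2i}(n,n)^2+\mathcal D_{a_2}^{2i}(n,n)^2\big)^{1/2}$; $\mathcal D_{a_1}^1(n,n)=\big(\mathcal D_{a_2}^1(n,n)^2+\sum_{i=0}^d|K_i^{\mathrm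 p}|_\infty^2\|d_{1i}[n]\|_{\mathrm F}^2+\sum_{i=1}^d\mathcal D_{a_1}^{2i}(n,n)^2\|d_{2i}[n]\|_{\mathrm F}^2\big)^{1/2}$; $\mathcal D_{d_{1i}}^1=\mathcal D_{d_{2i}}^2=I$; $\mathcal D_{d_{1i}}^2(n,n)=\big(|K_i^{\mathrm p}|_\infty^2+\mathcal D_{a_1}^{3i}(n,n)^2\big)^{1/2}$; $\mathcal D_{d_{2i}}^1(n,n)=\big(|K_i^{\mathrm p}|_\infty^2+\mathcal D_{a_2}^{2i}(n,n)^2\big)^{1/2}$. *)

theory Defs
  imports "HOL-Analysis.Analysis"
begin

text \<open>
  The dimensions d, M, N are the cardinalities of the finite types \<open>'d\<close>, \<open>'m\<close>, \<open>'n\<close>. Indices that run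
  over d + 1 values live in \<open>'d option\<close>: \<open>None\<close> is the time index (index 0; the first column of
  \<open>W1\<close>), and \<open>Some i\<close> belongs to the spatial variable \<open>x\<^sub>i\<close> (index i; column i + 1 of \<open>W1\<close>).
  Row vectors are matrices with one row, of type \<open>real^'n^1\<close>.

  On \<open>real^'n^'m\<close> the library operation \<open>*\<close> is entrywise, so it is the Hadamard product, and
  \<open>1\<close> is the all-one matrix. The matrix product is \<open>**\<close> and the identity matrix is \<open>mat 1\<close>.
  The library \<open>norm\<close> is the Frobenius norm there, and \<open>infnorm\<close> the largest absolute value
  of an entry.
\<close>

definition vec_map :: "('a \<Rightarrow> 'b) \<Rightarrow> 'a^'k \<Rightarrow> 'b^'k" where
  "vec_map f v = (\<chi> i. f (v $ i))"

definition mat_map :: "('a \<Rightarrow> 'b) \<Rightarrow> 'a^'n^'m \<Rightarrow> 'b^'n^'m" where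
  "mat_map f A = vec_map (vec_map f) A"

text \<open>\<open>spread b\<close> is \<open>b\<close> times the transpose of the all-one column vector.\<close>

definition spread :: "real^'m \<Rightarrow> real^'n^'m" where
  "spread b = columnvector b ** (rowvector 1 :: real^'n^1)"

definition diag_mat :: "('n \<Rightarrow> real) \<Rightarrow> real^'n^'n" where
  "diag_mat f = (\<chi> i j. if i = j then f i else 0)"

definition wnorm :: "real^'n^'n \<Rightarrow> real^'n^'m \<Rightarrow> real" where
  "wnorm D A = sqrt (\<Sum>n\<in>UNIV. (D $ n $ n)\<^sup>2 * (norm (column n A))\<^sup>2)"

text \<open>\<open>C1_on U f\<close>: \<open>f\<close> is continuously (Frechet) differentiable on the open set \<open>U\<close>.\<close>

definition C1_on :: "'a::real_normed_vector set \<Rightarrow> ('a \<Rightarrow> real) \<Rightarrow> bool" where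
  "C1_on U f \<longleftrightarrow>
     (\<exists>f' :: 'a \<Rightarrow> 'a \<Rightarrow>\<^sub>L real.
        (\<forall>x\<in>U. (f has_derivative blinfun_apply (f' x)) (at x)) \<and> continuous_on U f')"

definition partial_deriv :: "'d \<Rightarrow> (real^'d \<Rightarrow> real) \<Rightarrow> real^'d \<Rightarrow> real" where
  "partial_deriv i f x = deriv (\<lambda>s. f (x + s *\<^sub>R axis i 1)) 0"

definition grad :: "(real^'d \<Rightarrow> real) \<Rightarrow> real^'d \<Rightarrow> real^'d" where
  "grad f x = (\<chi> i. partial_deriv i f x)"

definition divergence :: "(real^'d \<Rightarrow> real^'d) \<Rightarrow> real^'d \<Rightarrow> real" where
  "divergence F x = (\<Sum>i\<in>UNIV. partial_deriv i (\<lambda>z. F z $ i) x)"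

definition time_space :: "real \<Rightarrow> real^'d \<Rightarrow> real^('d option)" where
  "time_space t x = (\<chi> j. case j of None \<Rightarrow> t | Some i \<Rightarrow> x $ i)"

text \<open>
  Each definition below takes as explicit arguments, outside the context block, those of the fixed
  variables it depends on, in the order in which they are fixed. The functions \<open>t\<close>, \<open>x\<close>, \<open>y\<close> list
  the data \<open>t\<^sub>n\<close>, \<open>x\<^sub>n\<close>, \<open>y\<^sub>n\<close>; \<open>d1 None\<close> and \<open>d1 (Some i)\<close> are the auxiliary matrices
  \<open>d\<^sub>1\<^sub>0\<close> and \<open>d\<^sub>1\<^sub>i\<close>, and likewise for \<open>d2\<close>.
\<close>

context
  fixes \<sigma> :: "real \<Rightarrow> real"
    and c :: "real^'d \<Rightarrow> real"
    and t :: "'n::finite \<Rightarrow> real"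
    and x :: "'n \<Rightarrow> real^'d"
    and y :: "'n \<Rightarrow> real"
    and W1 :: "real^('d option)^'m"
    and W2 :: "real^'m^'m"
    and W3 :: "real^'m^1"
    and b1 :: "real^'m"
    and b2 :: "real^'m"
    and b3 :: real
    and a1 :: "real^'n^'m"
    and a2 :: "real^'n^'m"
    and d1 :: "'d option \<Rightarrow> real^'n^'m"
    and d2 :: "'d option \<Rightarrow> real^'n^'m"
    and q :: "'d \<Rightarrow> real^'n^'m"
begin

definition net :: "real \<Rightarrow> real^'d \<Rightarrow> real" where
  "net s z =
     (W3 *v vec_map \<sigma> (W2 *v vec_map \<sigma> (W1 *v time_space s z + b1) + b2)) $ 1 + b3"

definition net_p :: "real \<Rightarrow> real^'d \<Rightarrow> real" where
  "net_p s z = s * ((norm z)\<^sup>2 - 1) * net s z"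

definition pinn_loss :: real where
  "pinn_loss = 1 / real CARD('n) *
     (\<Sum>n\<in>UNIV. \<bar>deriv (\<lambda>s. net_p s (x n)) (t n)
        - divergence (\<lambda>z. c z *\<^sub>R grad (net_p (t n)) z) (x n) - y n\<bar>\<^sup>2)"

definition mat_X :: "real^'n^'d" where
  "mat_X = (\<chi> i n. x n $ i)"

definition row_X :: "'d \<Rightarrow> real^'n^1" where
  "row_X i = rowvector (row i mat_X)"

definition row_Xhat :: "real^'n^1" where
  "row_Xhat = (\<chi> r n. (norm (x n))\<^sup>2)"

definition row_Y :: "real^'n^1" where
  "row_Y = (\<chi> r n. y n)"

definition row_T :: "real^'n^1" where
  "row_T = (\<chi> r n. t n)"

definition mat_XT :: "real^'n^('d option)" where
  "mat_XT = (\<chi> j. case j of None \<Rightarrow> row_T $ 1 | Some i \<Rightarrow> mat_X $ i)"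

definition row_c :: "real^'n^1" where
  "row_c = (\<chi> r n. c (x n))"

definition row_dc :: "'d \<Rightarrow> real^'n^1" where
  "row_dc i = (\<chi> r n. partial_deriv i c (x n))"

text \<open>\<open>K_main\<close> is \<open>K\<close> without index; \<open>K_ix None\<close> is \<open>K\<^sub>0\<close> and \<open>K_ix (Some i)\<close> is \<open>K\<^sub>i\<close>.\<close>

definition K_main :: "real^'n^1" where
  "K_main = (row_Xhat - 1) - (2 * real CARD('d)) *\<^sub>R (row_c * row_T)
     - 2 *\<^sub>R (row_T * (\<Sum>i\<in>UNIV. row_dc i * row_X i))"

definition K_ix :: "'d option \<Rightarrow> real^'n^1" where
  "K_ix j = (case j of
       None \<Rightarrow> row_T * (row_Xhat - 1)
     | Some i \<Rightarrow> row_T * ((row_Xhat - 1) * row_dc i + 4 *\<^sub>R (row_X i * row_c)))"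

definition K_hat :: "real^'n^1" where
  "K_hat = row_c * row_T * (row_Xhat - 1)"

text \<open>
  Weights: \<open>w_v_k\<close> is the weight with lower index \<open>v\<close> and upper index \<open>k\<close>; in \<open>w_a1_2 i\<close> and the
  like the upper index is \<open>2i\<close>. The diagonal matrices \<open>D_v_k\<close> are named in the same way.
\<close>

definition w_a1_1 :: real where
  "w_a1_1 = (norm W3)\<^sup>2 * (norm W2)\<^sup>2"

definition w_d1_2 :: "'d \<Rightarrow> real" where
  "w_d1_2 i = (norm W3)\<^sup>2 * (norm W2)\<^sup>2"

definition w_a1_2 :: "'d \<Rightarrow> real" where
  "w_a1_2 i = w_a1_1 * (norm (column (Some i) W1))\<^sup>2"

definition w_a2_2 :: "'d \<Rightarrow> real" where
  "w_a2_2 i = w_a1_1 * (norm (column (Some i) W1))\<^sup>2"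

definition w_a1_3 :: "'d \<Rightarrow> real" where
  "w_a1_3 i = w_a1_2 i * (norm W2)\<^sup>2"

definition w_a2_1 :: real where
  "w_a2_1 = (norm W3)\<^sup>2"

definition w_d2_1 :: "'d \<Rightarrow> real" where
  "w_d2_1 i = (norm W3)\<^sup>2"

definition w_d10 :: real where
  "w_d10 = (infnorm (K_ix None))\<^sup>2 * w_a1_1"

definition w_d20 :: real where
  "w_d20 = (infnorm (K_ix None))\<^sup>2 * w_a2_1"

definition w_d1_1 :: "'d \<Rightarrow> real" where
  "w_d1_1 i = (infnorm K_hat)\<^sup>2 * (w_a1_2 i + w_a1_3 i)"

definition w_d2_2 :: "'d \<Rightarrow> real" where
  "w_d2_2 i = (infnorm K_hat)\<^sup>2 * w_a1_2 i"

definition w_q :: "'d \<Rightarrow> real" where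
  "w_q i = (infnorm K_hat)\<^sup>2 * w_a2_1"

definition D_a2_1 :: "real^'n^'n" where
  "D_a2_1 = diag_mat (\<lambda>n. sqrt ((infnorm K_main)\<^sup>2
     + (\<Sum>j\<in>UNIV. (infnorm (K_ix j))\<^sup>2 * (norm (column n (d2 j)))\<^sup>2)
     + (infnorm K_hat)\<^sup>2 * (\<Sum>i\<in>UNIV. (norm (column n (q i)))\<^sup>2)))"

definition D_a1_2 :: "'d \<Rightarrow> real^'n^'n" where
  "D_a1_2 i = diag_mat (\<lambda>n. infnorm K_hat * norm (column n (d1 (Some i))))"

definition D_a2_2 :: "'d \<Rightarrow> real^'n^'n" where
  "D_a2_2 i = diag_mat (\<lambda>n. infnorm K_hat * norm (column n (d2 (Some i))))"

definition D_a1_3 :: "'d \<Rightarrow> real^'n^'n" where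
  "D_a1_3 i = diag_mat (\<lambda>n. sqrt ((D_a1_2 i $ n $ n)\<^sup>2 + (D_a2_2 i $ n $ n)\<^sup>2))"

definition D_a1_1 :: "real^'n^'n" where
  "D_a1_1 = diag_mat (\<lambda>n. sqrt ((D_a2_1 $ n $ n)\<^sup>2
     + (\<Sum>j\<in>UNIV. (infnorm (K_ix j))\<^sup>2 * (norm (column n (d1 j)))\<^sup>2)
     + (\<Sum>i\<in>UNIV. (D_a1_2 i $ n $ n)\<^sup>2 * (norm (column n (d2 (Some i))))\<^sup>2)))"

definition D_d1_1 :: "'d \<Rightarrow> real^'n^'n" where
  "D_d1_1 i = mat 1"

definition D_d2_2 :: "'d \<Rightarrow> real^'n^'n" where
  "D_d2_2 i = mat 1"

definition D_d1_2 :: "'d \<Rightarrow> real^'n^'n" where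
  "D_d1_2 i =
     diag_mat (\<lambda>n. sqrt ((infnorm (K_ix (Some i)))\<^sup>2 + (D_a1_3 i $ n $ n)\<^sup>2))"

definition D_d2_1 :: "'d \<Rightarrow> real^'n^'n" where
  "D_d2_1 i =
     diag_mat (\<lambda>n. sqrt ((infnorm (K_ix (Some i)))\<^sup>2 + (D_a2_2 i $ n $ n)\<^sup>2))"

definition res_pde :: "real^'n^1" where
  "res_pde =
       K_main * (W3 ** mat_map \<sigma> a2 + b3 *\<^sub>R 1)
     + K_ix None * (W3 ** (mat_map (deriv \<sigma>) a2 * d2 None))
     - (\<Sum>i\<in>UNIV. K_ix (Some i) * (W3 ** (mat_map (deriv \<sigma>) a2 * d2 (Some i))))
     - K_hat * (\<Sum>i\<in>UNIV. W3 ** (mat_map (deriv (deriv \<sigma>)) a2 * d2 (Some i) * d2 (Some i)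
                                      + mat_map (deriv \<sigma>) a2 * q i))
     - row_Y"

definition res_a1 :: "real^'n^'m" where
  "res_a1 = W1 ** mat_XT + spread b1 - a1"

definition res_a2 :: "real^'n^'m" where
  "res_a2 = W2 ** mat_map \<sigma> a1 + spread b2 - a2"

definition res_d1 :: "'d option \<Rightarrow> real^'n^'m" where
  "res_d1 j = spread (column j W1) - d1 j"

definition res_d2 :: "'d option \<Rightarrow> real^'n^'m" where
  "res_d2 j = W2 ** (mat_map (deriv \<sigma>) a1 * d1 j) - d2 j"

definition res_q :: "'d \<Rightarrow> real^'n^'m" where
  "res_q i = W2 ** (mat_map (deriv (deriv \<sigma>)) a1 * d1 (Some i) * d1 (Some i)) - q i"

definition layer_sep_loss :: real where
  "layer_sep_loss = 1 / real CARD('n) *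
     ((norm res_pde)\<^sup>2
      + w_a1_1 * (wnorm D_a1_1 res_a1)\<^sup>2
      + (\<Sum>i\<in>UNIV. w_a1_2 i * (wnorm (D_a1_2 i) res_a1)\<^sup>2)
      + (\<Sum>i\<in>UNIV. w_a1_3 i * (wnorm (D_a1_3 i) res_a1)\<^sup>2)
      + w_a2_1 * (wnorm D_a2_1 res_a2)\<^sup>2
      + (\<Sum>i\<in>UNIV. w_a2_2 i * (wnorm (D_a2_2 i) res_a2)\<^sup>2)
      + w_d10 * (norm (res_d1 None))\<^sup>2
      + w_d20 * (norm (res_d2 None))\<^sup>2
      + (\<Sum>i\<in>UNIV. w_d1_1 i * (wnorm (D_d1_1 i) (res_d1 (Some i)))\<^sup>2
                  + w_d2_1 i * (wnorm (D_d2_1 i) (res_d2 (Some i)))\<^sup>2)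
      + (\<Sum>i\<in>UNIV. w_d1_2 i * (wnorm (D_d1_2 i) (res_d1 (Some i)))\<^sup>2
                  + w_d2_2 i * (wnorm (D_d2_2 i) (res_d2 (Some i)))\<^sup>2)
      + (\<Sum>i\<in>UNIV. w_q i * (norm (res_q i))\<^sup>2))"

end

end

theory Submission
  imports Defs
begin

text \<open>
  Let the auxiliary variables be the exact values of the forward pass: pre-activations and their first
  and second directional derivatives along the coordinate axes. Then every layer residual vanishes, and
  the product and chain rules identify the remaining term with the residual of the differential
  equation, so that the two losses agree.
\<close>

section \<open>Derivatives of the two-hidden-layer network along straight lines\<close>

context
  fixes \<sigma> :: "real \<Rightarrow> real"
    and W1 :: "real^'k^'m" and W2 :: "real^'m^'m" and W3 :: "real^'m^1"
    and b1 b2 :: "real^'m" and b3 :: real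
begin

definition hid1 :: "real^'k \<Rightarrow> real^'m" where
  "hid1 p = W1 *v p + b1"

definition hid2 :: "real^'k \<Rightarrow> real^'m" where
  "hid2 p = W2 *v vec_map \<sigma> (hid1 p) + b2"

text \<open>Directional derivative of \<open>hid2\<close> along \<open>v\<close>; the factor
  \<open>W1 *v v\<close> is the constant slope of the affine map \<open>hid1\<close>.\<close>

definition dhid2 :: "real^'k \<Rightarrow> real^'k \<Rightarrow> real^'m" where
  "dhid2 v p = W2 *v (vec_map (deriv \<sigma>) (hid1 p) * (W1 *v v))"

text \<open>Second directional derivative of \<open>hid2\<close>. Since \<open>hid1\<close> is
  affine, no term with \<open>deriv \<sigma>\<close> arises here, unlike in \<open>ddoutp\<close>,
  where the inner map \<open>hid2\<close> contributes \<open>ddhid2\<close>.\<close>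

definition ddhid2 :: "real^'k \<Rightarrow> real^'k \<Rightarrow> real^'m" where
  "ddhid2 v p = W2 *v (vec_map (deriv (deriv \<sigma>)) (hid1 p) * (W1 *v v) * (W1 *v v))"

definition outp :: "real^'k \<Rightarrow> real" where
  "outp p = (W3 *v vec_map \<sigma> (hid2 p)) $ 1 + b3"

definition doutp :: "real^'k \<Rightarrow> real^'k \<Rightarrow> real" where
  "doutp v p = (W3 *v (vec_map (deriv \<sigma>) (hid2 p) * dhid2 v p)) $ 1"

definition ddoutp :: "real^'k \<Rightarrow> real^'k \<Rightarrow> real" where
  "ddoutp v p =
     (W3 *v (vec_map (deriv (deriv \<sigma>)) (hid2 p) * dhid2 v p * dhid2 v p
             + vec_map (deriv \<sigma>) (hid2 p) * ddhid2 v p)) $ 1"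

context
  assumes diff: "\<And>s. \<sigma> differentiable (at s)"
    and diff': "\<And>s. deriv \<sigma> differentiable (at s)"
begin

lemma DERIV_act: "(g has_real_derivative g') (at h) \<Longrightarrow>
    ((\<lambda>h. \<sigma> (g h)) has_real_derivative deriv \<sigma> (g h) * g') (at h)"
  using DERIV_chain2 DERIV_deriv_iff_real_differentiable diff by blast

lemma DERIV_deriv_act: "(g has_real_derivative g') (at h) \<Longrightarrow>
    ((\<lambda>h. deriv \<sigma> (g h)) has_real_derivative deriv (deriv \<sigma>) (g h) * g') (at h)"
  using DERIV_chain2 DERIV_deriv_iff_real_differentiable diff' by blast

text \<open>Along a line, \<open>hid1\<close> is affine in the parameter. This and the next
  derivatives hold at every \<open>h\<close>, not only at 0, so that the parameter can later be time
  itself.\<close>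

lemma DERIV_hid1:
  "((\<lambda>h. hid1 (p + h *\<^sub>R v) $ l) has_real_derivative (W1 *v v) $ l) (at h)"
proof -
  have "(\<lambda>h. hid1 (p + h *\<^sub>R v) $ l) = (\<lambda>h. hid1 p $ l + h * (W1 *v v) $ l)"
    by (simp add: hid1_def matrix_vector_right_distrib matrix_vector_mult_scaleR fun_eq_iff)
  then show ?thesis
    by (auto intro!: derivative_eq_intros)
qed

lemma DERIV_hid2:
  "((\<lambda>h. hid2 (p + h *\<^sub>R v) $ k) has_real_derivative dhid2 v (p + h *\<^sub>R v) $ k) (at h)"
  unfolding hid2_def dhid2_def
  by (auto intro!: derivative_eq_intros DERIV_act DERIV_hid1 sum.cong
      simp: matrix_vector_mult_def vec_map_def vector_mult_component)

lemma DERIV_dhid2: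
  "((\<lambda>h. dhid2 v (p + h *\<^sub>R v) $ k) has_real_derivative ddhid2 v (p + h *\<^sub>R v) $ k) (at h)"
  \<comment> \<open>Expanding only the product with \<open>W2\<close> keeps \<open>W1 *v v\<close>
    closed, as a factor independent of \<open>h\<close>.\<close>
  unfolding dhid2_def ddhid2_def matrix_vector_mult_def[of W2]
  by (auto intro!: derivative_eq_intros DERIV_deriv_act DERIV_hid1 sum.cong
      simp: vec_map_def vector_mult_component)

lemma DERIV_outp:
  "((\<lambda>h. outp (p + h *\<^sub>R v)) has_real_derivative doutp v (p + h *\<^sub>R v)) (at h)"
  unfolding outp_def doutp_def
  by (auto intro!: derivative_eq_intros DERIV_act DERIV_hid2 sum.cong
      simp: matrix_vector_mult_def vec_map_def vector_mult_component)

lemma DERIV_doutp: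
  "((\<lambda>h. doutp v (p + h *\<^sub>R v)) has_real_derivative ddoutp v (p + h *\<^sub>R v)) (at h)"
  unfolding doutp_def ddoutp_def matrix_vector_mult_def[of W3]
  by (auto intro!: derivative_eq_intros DERIV_deriv_act DERIV_hid2 DERIV_dhid2 sum.cong
      simp: vec_map_def vector_mult_component algebra_simps)

end

end

section \<open>Time and space derivatives of the network, the ansatz and the flux\<close>

lemma net_eq_outp: "net \<sigma> W1 W2 W3 b1 b2 b3 s z = outp \<sigma> W1 W2 W3 b1 b2 b3 (time_space s z)"
  by (simp add: net_def outp_def hid1_def hid2_def)

text \<open>Turns partial derivatives in space into directional derivatives of
  \<open>outp\<close>.\<close>

lemma time_space_shift_space:
  "time_space s (z + h *\<^sub>R axis i 1) = time_space s z + h *\<^sub>R axis (Some i) 1"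
  by (auto simp: time_space_def vec_eq_iff axis_def split: option.splits)

text \<open>Based at time 0, so that the line parameter is the absolute time and derivatives at any
  \<open>s\<close> follow.\<close>

lemma time_space_shift_time: "time_space s z = time_space 0 z + s *\<^sub>R axis None 1"
  by (auto simp: time_space_def vec_eq_iff axis_def split: option.splits)

lemma DERIV_norm_sq_axis:
  fixes z :: "real^'d"
  shows "((\<lambda>h. (norm (z + h *\<^sub>R axis i 1))\<^sup>2) has_real_derivative 2 * z $ i) (at 0)"
proof -
  have "(\<lambda>h. (norm (z + h *\<^sub>R axis i 1))\<^sup>2) = (\<lambda>h. (norm z)\<^sup>2 + 2 * h * z $ i + h\<^sup>2)"
    by (auto simp: fun_eq_iff power2_norm_eq_inner algebra_simps inner_add_left inner_add_right
        inner_axis inner_axis' inner_axis_axis simp flip: power2_eq_square)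
  then show ?thesis
    by (auto intro!: derivative_eq_intros)
qed

text \<open>Composing the Frechet derivative with the coordinate line shows that the derivative
  exists, so the \<open>deriv\<close> inside \<open>partial_deriv\<close> is a genuine
  derivative.\<close>

lemma C1_on_partial_deriv:
  assumes "C1_on U c" "z \<in> U"
  shows "((\<lambda>h. c (z + h *\<^sub>R axis i 1)) has_real_derivative partial_deriv i c z) (at 0)"
proof -
  obtain c' where c': "(c has_derivative c') (at z)"
    using assms unfolding C1_on_def by blast
  have "((\<lambda>h. c (z + h *\<^sub>R axis i 1)) has_derivative (\<lambda>h. c' (h *\<^sub>R axis i 1))) (at 0)"
    by (rule has_derivative_compose[where g=c]) (auto intro!: derivative_eq_intros c')
  then have "(\<lambda>h. c (z + h *\<^sub>R axis i 1)) differentiable (at 0)"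
    by (auto simp: differentiable_def)
  then show ?thesis
    by (simp add: partial_deriv_def DERIV_deriv_iff_real_differentiable)
qed

context
  fixes \<sigma> :: "real \<Rightarrow> real"
    and W1 :: "real^('d::finite option)^'m" and W2 :: "real^'m^'m" and W3 :: "real^'m^1"
    and b1 b2 :: "real^'m" and b3 :: real
  assumes diff: "\<And>s. \<sigma> differentiable (at s)"
    and diff': "\<And>s. deriv \<sigma> differentiable (at s)"
begin

abbreviation "out0 s z \<equiv> outp \<sigma> W1 W2 W3 b1 b2 b3 (time_space s z)"
abbreviation "out1 j s z \<equiv> doutp \<sigma> W1 W2 W3 b1 b2 (axis j 1) (time_space s z)"
abbreviation "out2 j s z \<equiv> ddoutp \<sigma> W1 W2 W3 b1 b2 (axis j 1) (time_space s z)"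

lemma DERIV_out0_space:
  "((\<lambda>h. out0 s (z + h *\<^sub>R axis i 1)) has_real_derivative out1 (Some i) s z) (at 0)"
  using DERIV_outp[OF diff diff', of W1 W2 W3 b1 b2 b3 "time_space s z" "axis (Some i) 1" 0]
  by (simp add: time_space_shift_space)

lemma DERIV_out1_space:
  "((\<lambda>h. out1 (Some i) s (z + h *\<^sub>R axis i 1)) has_real_derivative out2 (Some i) s z) (at 0)"
  using DERIV_doutp[OF diff diff', of W1 W2 W3 b1 b2 "axis (Some i) 1" "time_space s z" 0]
  by (simp add: time_space_shift_space)

lemma DERIV_out0_time: "((\<lambda>s. out0 s z) has_real_derivative out1 None s z) (at s)"
  using DERIV_outp[OF diff diff', of W1 W2 W3 b1 b2 b3 "time_space 0 z" "axis None 1" s]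
  by (simp add: time_space_shift_time[symmetric])

lemma deriv_time_net_p:
  "deriv (\<lambda>s. net_p \<sigma> W1 W2 W3 b1 b2 b3 s z) s =
     ((norm z)\<^sup>2 - 1) * out0 s z + s * ((norm z)\<^sup>2 - 1) * out1 None s z"
  unfolding net_p_def net_eq_outp
  by (rule DERIV_imp_deriv) (auto intro!: derivative_eq_intros DERIV_out0_time)

lemma grad_net_p:
  "grad (net_p \<sigma> W1 W2 W3 b1 b2 b3 s) z $ i =
     s * (2 * z $ i * out0 s z + ((norm z)\<^sup>2 - 1) * out1 (Some i) s z)"
  unfolding grad_def partial_deriv_def net_p_def net_eq_outp
  by simp (rule DERIV_imp_deriv,
    (rule DERIV_norm_sq_axis DERIV_out0_space derivative_eq_intros refl)+, simp add: algebra_simps)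

text \<open>Product rule in each coordinate. The coefficient 4 collects two equal cross terms: one
  from the factor \<open>z $ i\<close> of the gradient formula, one from differentiating the squared
  norm.\<close>

lemma divergence_flux_net_p:
  assumes "C1_on U c" "z \<in> U"
  shows "divergence (\<lambda>z. c z *\<^sub>R grad (net_p \<sigma> W1 W2 W3 b1 b2 b3 s) z) z =
    (\<Sum>i\<in>UNIV. partial_deriv i c z *
        (s * (2 * z $ i * out0 s z + ((norm z)\<^sup>2 - 1) * out1 (Some i) s z))
      + c z * (s * (2 * out0 s z + 4 * z $ i * out1 (Some i) s z
          + ((norm z)\<^sup>2 - 1) * out2 (Some i) s z)))"
proof -
  have comp: "((\<lambda>h. (z + h *\<^sub>R axis i 1) $ i) has_real_derivative 1) (at 0)" for i
    by (auto intro!: derivative_eq_intros)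
  show ?thesis
    unfolding divergence_def
  proof (rule sum.cong)
    fix i
    show "partial_deriv i (\<lambda>z. (c z *\<^sub>R grad (net_p \<sigma> W1 W2 W3 b1 b2 b3 s) z) $ i) z =
       partial_deriv i c z *
        (s * (2 * z $ i * out0 s z + ((norm z)\<^sup>2 - 1) * out1 (Some i) s z))
      + c z * (s * (2 * out0 s z + 4 * z $ i * out1 (Some i) s z
          + ((norm z)\<^sup>2 - 1) * out2 (Some i) s z))"
      \<comment> \<open>The gradient formula holds at every point, so its closed form may be
        differentiated again. Only the outer partial derivative is unfolded;
        \<open>partial_deriv i c z\<close> stays.\<close>
      unfolding vector_scaleR_component grad_net_p real_scaleR_def
      by (subst partial_deriv_def, rule DERIV_imp_deriv,
          (rule C1_on_partial_deriv[OF assms] comp DERIV_out0_space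
            DERIV_out1_space DERIV_norm_sq_axis derivative_eq_intros refl)+)
        (simp add: algebra_simps)
  qed simp
qed

end

section \<open>Matrices as families of columns, one per sample\<close>

lemma wnorm_zero: "wnorm D 0 = 0"
  by (simp add: wnorm_def column_def vec_eq_iff zero_vec_def[symmetric])

lemma norm_row_sq:
  fixes A :: "real^'n^1"
  shows "(norm A)\<^sup>2 = (\<Sum>n\<in>UNIV. (A $ 1 $ n)\<^sup>2)"
  by (simp add: power2_norm_eq_inner inner_vec_def sum_1 flip: power2_eq_square)

text \<open>In the form \<open>\<chi> k n. f n $ k\<close> the matrix has \<open>f n\<close> as its
  column \<open>n\<close>. Together with the lemmas below, this reduces each layer operation to one
  sample.\<close>

lemma matrix_mult_columns:
  fixes A :: "real^'k^'m" and f :: "'n::finite \<Rightarrow> real^'k"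
  shows "A ** (\<chi> k n. f n $ k) = (\<chi> i n. (A *v f n) $ i)"
  by (simp add: matrix_matrix_mult_def matrix_vector_mult_def)

lemma mat_map_columns: "mat_map g (\<chi> k n. f n $ k) = (\<chi> k n. vec_map g (f n) $ k)"
  by (simp add: mat_map_def vec_map_def vec_eq_iff)

lemma times_columns:
  "(\<chi> k n. f n $ k) * (\<chi> k n. g n $ k) = (\<chi> k n. (f n * g n) $ k)"
  by (simp add: vec_eq_iff vector_mult_component)

lemma plus_columns:
  "(\<chi> k n. f n $ k) + (\<chi> k n. g n $ k) = (\<chi> k n. (f n + g n) $ k)"
  by (simp add: vec_eq_iff)

lemma spread_columns: "spread b = (\<chi> k n. b $ k)"
  by (simp add: spread_def columnvector_def rowvector_def matrix_matrix_mult_def vec_eq_iff sum_1)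

lemma mat_XT_columns: "mat_XT t x = (\<chi> j n. time_space (t n) (x n) $ j)"
  by (auto simp: mat_XT_def time_space_def row_T_def mat_X_def vec_eq_iff split: option.splits)

theorem theorem3p2:
  fixes \<sigma> :: "real \<Rightarrow> real"
    and c :: "real^'d \<Rightarrow> real" and \<delta> T :: real
    and Q :: "real \<Rightarrow> real^'d \<Rightarrow> real"
    and t :: "'n::finite \<Rightarrow> real" and x :: "'n \<Rightarrow> real^'d" and y :: "'n \<Rightarrow> real"
    and U :: "(real^'d) set"
    and W1 :: "real^('d option)^'m" and W2 :: "real^'m^'m" and W3 :: "real^'m^1"
    and b1 b2 :: "real^'m" and b3 :: real
  assumes "\<And>s. \<sigma> differentiable (at s)"
    and "\<And>s. deriv \<sigma> differentiable (at s)"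
    and "T > 0"
    and "open U" and "cball 0 1 \<subseteq> U" and "C1_on U c"
    and "\<delta> > 0" and "\<And>z. z \<in> cball 0 1 \<Longrightarrow> c z > \<delta>"
    and "\<And>n. t n \<in> {0..T}" and "\<And>n. x n \<in> cball 0 1"
    and "\<And>n. y n = Q (t n) (x n)"
  shows "\<exists>(a1 :: real^'n^'m) (a2 :: real^'n^'m)
           (d1 :: 'd option \<Rightarrow> real^'n^'m) (d2 :: 'd option \<Rightarrow> real^'n^'m)
           (q :: 'd \<Rightarrow> real^'n^'m).
           layer_sep_loss \<sigma> c t x y W1 W2 W3 b1 b2 b3 a1 a2 d1 d2 q
             \<le> pinn_loss \<sigma> c t x y W1 W2 W3 b1 b2 b3"
proof -
  define p where "p n = time_space (t n) (x n)" for n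
  define a1 :: "real^'n^'m" where "a1 = (\<chi> k n. hid1 W1 b1 (p n) $ k)"
  define a2 :: "real^'n^'m" where "a2 = (\<chi> k n. hid2 \<sigma> W1 W2 b1 b2 (p n) $ k)"
  \<comment> \<open>The columns do not depend on \<open>n\<close>, since the first layer is affine;
    each is column \<open>j\<close> of \<open>W1\<close>.\<close>
  define d1 :: "'d option \<Rightarrow> real^'n^'m" where "d1 j = (\<chi> k n. (W1 *v axis j 1) $ k)" for j
  define d2 :: "'d option \<Rightarrow> real^'n^'m" where
    "d2 j = (\<chi> k n. dhid2 \<sigma> W1 W2 b1 (axis j 1) (p n) $ k)" for j
  define q :: "'d \<Rightarrow> real^'n^'m" where
    "q i = (\<chi> k n. ddhid2 \<sigma> W1 W2 b1 (axis (Some i) 1) (p n) $ k)" for i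
  note columns = matrix_mult_columns mat_map_columns times_columns plus_columns spread_columns
  have r_a1: "res_a1 t x W1 b1 a1 = 0"
    unfolding res_a1_def mat_XT_columns a1_def columns hid1_def p_def by simp
  have r_a2: "res_a2 \<sigma> W2 b2 a1 a2 = 0"
    unfolding res_a2_def a1_def a2_def columns hid2_def by simp
  have r_d1: "res_d1 W1 d1 j = 0" for j
    unfolding res_d1_def d1_def spread_columns matrix_vector_mult_basis by simp
  have r_d2: "res_d2 \<sigma> W2 a1 d1 d2 j = 0" for j
    unfolding res_d2_def a1_def d1_def d2_def columns dhid2_def by simp
  have r_q: "res_q \<sigma> W2 a1 d1 q i = 0" for i
    unfolding res_q_def a1_def d1_def q_def columns ddhid2_def by simp
  \<comment> \<open>The products with \<open>W3\<close> are the network value and its first and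
    second partial derivatives at the samples.\<close>
  have W3_a2: "W3 ** mat_map \<sigma> a2 + b3 *\<^sub>R 1 = (\<chi> r n. outp \<sigma> W1 W2 W3 b1 b2 b3 (p n))"
    unfolding a2_def columns by (simp add: vec_eq_iff outp_def)
  have W3_d2: "W3 ** (mat_map (deriv \<sigma>) a2 * d2 j) =
      (\<chi> r n. doutp \<sigma> W1 W2 W3 b1 b2 (axis j 1) (p n))" for j
    unfolding a2_def d2_def columns by (simp add: vec_eq_iff doutp_def)
  have W3_q: "W3 ** (mat_map (deriv (deriv \<sigma>)) a2 * d2 (Some i) * d2 (Some i)
        + mat_map (deriv \<sigma>) a2 * q i) =
      (\<chi> r n. ddoutp \<sigma> W1 W2 W3 b1 b2 (axis (Some i) 1) (p n))" for i
    unfolding a2_def d2_def q_def columns by (simp add: vec_eq_iff ddoutp_def)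
  \<comment> \<open>Collecting terms: the value gets \<open>K_main\<close>, whose dimension factor
    comes from summing \<open>2 * out0\<close> over the coordinates; first derivatives get
    \<open>K_ix\<close>, second ones \<open>K_hat\<close>.\<close>
  have "res_pde \<sigma> c t x y W3 b3 a2 d2 q $ 1 $ n =
      deriv (\<lambda>s. net_p \<sigma> W1 W2 W3 b1 b2 b3 s (x n)) (t n)
        - divergence (\<lambda>z. c z *\<^sub>R grad (net_p \<sigma> W1 W2 W3 b1 b2 b3 (t n)) z) (x n) - y n" for n
  proof -
    have xU: "x n \<in> U"
      using assms(5,10) by blast
    show ?thesis
      unfolding res_pde_def W3_a2 W3_d2 W3_q deriv_time_net_p[OF assms(1,2)]
        divergence_flux_net_p[OF assms(1,2) assms(6) xU]
      by (simp add: K_main_def K_ix_def K_hat_def row_Xhat_def row_X_def row_Y_def row_T_def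
          row_c_def row_dc_def mat_X_def rowvector_def row_def vector_mult_component p_def
          algebra_simps sum.distrib sum_subtractf sum_distrib_left)
  qed
  then have "(norm (res_pde \<sigma> c t x y W3 b3 a2 d2 q))\<^sup>2 =
      (\<Sum>n\<in>UNIV. \<bar>deriv (\<lambda>s. net_p \<sigma> W1 W2 W3 b1 b2 b3 s (x n)) (t n)
        - divergence (\<lambda>z. c z *\<^sub>R grad (net_p \<sigma> W1 W2 W3 b1 b2 b3 (t n)) z) (x n) - y n\<bar>\<^sup>2)"
    by (simp add: norm_row_sq)
  \<comment> \<open>Each penalty is a weight times the squared norm of a zero matrix, so equality
    holds.\<close>
  then have "layer_sep_loss \<sigma> c t x y W1 W2 W3 b1 b2 b3 a1 a2 d1 d2 q =
      pinn_loss \<sigma> c t x y W1 W2 W3 b1 b2 b3"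
    by (simp add: layer_sep_loss_def pinn_loss_def r_a1 r_a2 r_d1 r_d2 r_q wnorm_zero)
  then show ?thesis
    by (metis order_refl)
qed

end
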